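(* Consider a VRPSD instance under the optimal restocking (OR) policy. Let $S\subseteq N$ be nonempty, $E_S\subseteq E(S)$, and $m_{E_S}\in\{1,\dots,\bar m(E_S)\}$. If $\xi_i\sim\mathrm{Poisson}(\mu_i)$ for all $i\in S$, then, with $\mathcal{L}^2_{E_S}$ the optimal value of the assignment problem defined in the context, $\mathcal{L}^2_{E_S}\le\bar{\mathcal{L}}(E_S,m_{E_S})$, i.e., $\mathcal{L}^2_{E_S}$ is a valid coefficient for the E-cut of $E_S$. In particular, for $E_S=E(S)$ and $m_{E_S}=m_S\in\{1,\dots,m(S)\}$, $\mathcal{L}^2_S:=\mathcal{L}^2_{E(S)}\le\mathcal{L}(S,m_S)$ is a valid coefficient for the S-cut of $S$.
   Context: **Instance.** Customers $N=\{1,\dots,n\}$, depot $0$, symmetric non-negative travel costs $c_{i,j}$ on $\{0\}\cup N$ satisfying the triangle inequality. $E(S)$ is the set of edges $\{i,j\}$ with $i\ne j\in S$. Demands $\xi_i$ are independent, supported in $\mathbb{Z}_{\ge0}$, with finite means $\mu_i$; capacity $Q$ is a positive integer; load factor $f>0$, $\max_i\mu_i\le fQ$. Penalties $0\le b^P\le b^F$; $c^F_i=b^F+2c_{0,i}$; $c^P_{i,j}=b^P+c_{0,i}+c_{0,j}-c_{i,j}$ ($c^P_{0,j}=b^P$). A path is a nonempty sequence of distinct customers; $\mathcal{P}$ is the set of paths $p$ with $\sum_{i\in N(p)}\mu_i\le fQ$, where $N(p)$ is the customer set. **OR recourse.** $\Psi(s,q)=\max\{\lceil(s-q)/Q\rceil,0\}$.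 For $p=(i_1,\dots,i_t)$, $i_0=0$, $q\in\{0,\dots,Q\}$: $F^p_{i_t}(q)=0$; for $j<t$, $F^p_{i_j}(q)=\min\{H^p_{i_{j+1}}(q),c^P_{i_j,i_{j+1}}+H^p_{i_{j+1}}(Q)\}$ with $H^p_i(q)=\mathbb{E}[c^F_i\Psi(\xi_i,q)+F^p_i(\Psi(\xi_i,q)Q+q-\xi_i)]$. $\mathcal{Q}_p=\mathcal{Q}^{\text{OR}}_p$ is the minimum of $F^p_{i_0}(Q)$ over $p$ and its reversal. **Partitions.** $\Pi(S,m)$: sets of $m$ feasible paths whose customer sets partition $S$; $m(S)=\min\{m:\Pi(S,m)\neq\emptyset\}$; $\mathcal{L}(S,m)=\min_{\pi\in\Pi(S,m)}\sum_{p\in\pi}\mathcal{Q}_p$. $\bar\Pi(E_S,m)$: those $\pi\in\Pi(S,m)$ all of whose paths use only edges of $E_S$ (single-customer paths allowed); $\bar m(E_S)=\min\{m:\bar\Pi(E_S,m)\ne\emptyset\}$; $\bar{\mathcal{L}}(E_S,m)=\min_{\pi\in\bar\Pi(E_S,m)}\sum_{p\in\pi}\mathcal{Q}_p$. Minima over empty sets are $+\infty$. A valid coefficient of the E-cut $\sum_{i\in S}\theta_i\ge\mathcal{L}_{E_S}(\sum_{e\in E_S}x_e-|S|+m_{E_S}+1)$ is one with $\mathcal{L}_{E_S}\le\bar{\mathcal{L}}(E_S,m_{E_S})$; similarly for the S-cut $\sum_{i\in S}\theta_i\ge\mathcal{L}_S(\sum_{e\in E(S)}x_e-|S|+m_S+1)$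 with $\mathcal{L}(S,m_S)$. **The bound $\mathcal{L}^2_{E_S}$.** Fix any indexing $i_1,\dots,i_{|S|}$ of $S$. For $k\in\{1,\dots,m_{E_S}\}$: $c^F_{(k)}=\min_{j\ge k}c^F_{i_j}$; $c^P_{(k)}=\min\{c^P_{i_j,i_\ell}:\{i_j,i_\ell\}\in E_S,\ j,\ell\ge k\}$ ($+\infty$ if there is none). Let $\bar\mu>0$ be such that every $\mu_i$, $i\in S$, is an integer multiple of $\bar\mu$; $\bar D=\frac1{\bar\mu}\sum_{i\in S}\mu_i$; $\bar n=\lfloor fQ/\bar\mu\rfloor$. Let $\rho^s$ be the $\mathrm{Poisson}(\bar\mu)$ probability of $s$. Define, for $q\in\{0,\dots,Q\}$, $\widetilde F^k_0(q)=0$ and for $\bar d\in\{1,\dots,\bar n\}$, $$\widetilde F^k_{\bar d}(q)=\min\{\widetilde H^k_{\bar d}(q),\;c^P_{(k)}+\widetilde H^k_{\bar d}(Q)\},\quad\widetilde H^k_{\bar d}(q)=\sum_{s=0}^\infty\left[c^F_{(k)}\Psi(s,q)+\widetilde F^k_{\bar d-1}(\Psi(s,q)Q+q-s)\right]\rho^s.$$ Let $\widetilde g_k(\bar d\bar\mu)=\widetilde F^k_{\bar d}(Q)$. Then $$\mathcal{L}^2_{E_S}=\min\sum_{k=1}^{m_{E_S}}\sum_{\ell=0}^{\bar n}\widetilde g_k(\ell\bar\mu)y_{k\ell}$$ over $y_{k\ell}\in\{0,1\}$ with $\sum_{\ell=0}^{\bar n}y_{k\ell}=1$ for each $k$ and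 $\sum_{k}\sum_{\ell}\ell\,y_{k\ell}=\bar D$ ($+\infty$ if infeasible). *)

theory Defs
  imports "HOL-Probability.Probability" "HOL-Library.Extended_Nat"
begin

text \<open>Vertex 0 is the depot and the customers are the vertices 1, ..., n.\<close>

record 'w vrpsd_data =
  num_cust :: nat
  cost :: "nat \<Rightarrow> nat \<Rightarrow> real"
  dem_space :: "'w measure"
  demand :: "nat \<Rightarrow> 'w \<Rightarrow> nat"
  capacity :: nat
  load_factor :: real
  pen_P :: real
  pen_F :: real

definition customers :: "'w vrpsd_data \<Rightarrow> nat set" where
  "customers I = {1..num_cust I}"

definition mean_dem :: "'w vrpsd_data \<Rightarrow> nat \<Rightarrow> real" where
  "mean_dem I i = (\<integral>\<omega>. real (demand I i \<omega>) \<partial>dem_space I)"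

text \<open>Costs are attached to edges, so nothing is required of the values \<open>cost I i i\<close>,
  which are never used.\<close>

locale vrpsd = prob_space "dem_space I" for I :: "'w vrpsd_data" +
  assumes cost_sym:
      "\<And>i j. \<lbrakk>i \<in> insert 0 (customers I); j \<in> insert 0 (customers I); i \<noteq> j\<rbrakk>
        \<Longrightarrow> cost I i j = cost I j i"
    and cost_nonneg:
      "\<And>i j. \<lbrakk>i \<in> insert 0 (customers I); j \<in> insert 0 (customers I); i \<noteq> j\<rbrakk>
        \<Longrightarrow> 0 \<le> cost I i j"
    and cost_triangle:
      "\<And>i j k. \<lbrakk>i \<in> insert 0 (customers I); j \<in> insert 0 (customers I);
          k \<in> insert 0 (customers I); i \<noteq> j; j \<noteq> k; i \<noteq> k\<rbrakk>
        \<Longrightarrow> cost I i k \<le> cost I i j + cost I j k"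
    and demand_indep: "indep_vars (\<lambda>_. count_space UNIV) (demand I) (customers I)"
    and demand_integrable:
      "\<And>i. i \<in> customers I \<Longrightarrow> integrable (dem_space I) (\<lambda>\<omega>. real (demand I i \<omega>))"
    and capacity_pos: "0 < capacity I"
    and load_factor_pos: "0 < load_factor I"
    and mean_dem_le: "\<And>i. i \<in> customers I \<Longrightarrow> mean_dem I i \<le> load_factor I * real (capacity I)"
    and pen_P_nonneg: "0 \<le> pen_P I"
    and pen_P_le_pen_F: "pen_P I \<le> pen_F I"

definition cF :: "'w vrpsd_data \<Rightarrow> nat \<Rightarrow> real" where
  "cF I i = pen_F I + 2 * cost I 0 i"

definition cP :: "'w vrpsd_data \<Rightarrow> nat \<Rightarrow> nat \<Rightarrow> real" where
  "cP I i j = (if i = 0 then pen_P I else pen_P I + cost I 0 i + cost I 0 j - cost I i j)"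

definition feasible_path :: "'w vrpsd_data \<Rightarrow> nat list \<Rightarrow> bool" where
  "feasible_path I p \<longleftrightarrow> p \<noteq> [] \<and> distinct p \<and> set p \<subseteq> customers I \<and>
     (\<Sum>i\<in>set p. mean_dem I i) \<le> load_factor I * real (capacity I)"

definition Psi :: "nat \<Rightarrow> nat \<Rightarrow> nat \<Rightarrow> nat" where
  "Psi Q s q = nat (max \<lceil>(real s - real q) / real Q\<rceil> 0)"

text \<open>Residual load after serving demand \<open>s\<close> with load \<open>q\<close> and the replenishments counted by
  \<open>Psi\<close>; the subtraction never truncates when \<open>Q > 0\<close>, as \<open>Psi Q s q * Q + q \<ge> s\<close>.\<close>

definition residual :: "nat \<Rightarrow> nat \<Rightarrow> nat \<Rightarrow> nat" where
  "residual Q s q = Psi Q s q * Q + q - s"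

text \<open>\<open>or_H I i G\<close> is the function \<open>H\<^sub>i\<close> when \<open>G\<close> is the cost-to-go function \<open>F\<^sub>i\<close>.
  \<open>or_F I i p\<close> is the cost-to-go function at vertex \<open>i\<close> when \<open>p\<close> is the part of the path
  that is still to be visited.\<close>

definition or_H :: "'w vrpsd_data \<Rightarrow> nat \<Rightarrow> (nat \<Rightarrow> real) \<Rightarrow> nat \<Rightarrow> real" where
  "or_H I i G q =
     (\<integral>\<omega>. cF I i * real (Psi (capacity I) (demand I i \<omega>) q)
          + G (residual (capacity I) (demand I i \<omega>) q) \<partial>dem_space I)"

primrec or_F :: "'w vrpsd_data \<Rightarrow> nat \<Rightarrow> nat list \<Rightarrow> nat \<Rightarrow> real" where
  "or_F I i [] = (\<lambda>q. 0)"
| "or_F I i (j # p) =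
     (\<lambda>q. min (or_H I j (or_F I j p) q) (cP I i j + or_H I j (or_F I j p) (capacity I)))"

definition or_cost :: "'w vrpsd_data \<Rightarrow> nat list \<Rightarrow> real" where
  "or_cost I p = min (or_F I 0 p (capacity I)) (or_F I 0 (rev p) (capacity I))"

definition edges_within :: "nat set \<Rightarrow> nat set set" where
  "edges_within S = {{i, j} | i j. i \<in> S \<and> j \<in> S \<and> i \<noteq> j}"

definition path_edges :: "nat list \<Rightarrow> nat set set" where
  "path_edges p = {{p ! j, p ! Suc j} | j. Suc j < length p}"

definition partitions :: "'w vrpsd_data \<Rightarrow> nat set \<Rightarrow> nat \<Rightarrow> nat list set set" where
  "partitions I S m = {\<pi>. finite \<pi> \<and> card \<pi> = m \<and> (\<forall>p\<in>\<pi>. feasible_path I p) \<and>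
     disjoint_family_on set \<pi> \<and> (\<Union>p\<in>\<pi>. set p) = S}"

definition edge_partitions ::
    "'w vrpsd_data \<Rightarrow> nat set \<Rightarrow> nat set set \<Rightarrow> nat \<Rightarrow> nat list set set" where
  "edge_partitions I S ES m = {\<pi> \<in> partitions I S m. \<forall>p\<in>\<pi>. path_edges p \<subseteq> ES}"

text \<open>In \<open>enat\<close> and \<open>ereal\<close> the infimum of the empty set is \<open>\<infinity>\<close>; all infima below range over
  finite sets of values or over sets of natural numbers, so they are minima otherwise.\<close>

definition min_paths :: "'w vrpsd_data \<Rightarrow> nat set \<Rightarrow> enat" where
  "min_paths I S = (INF m\<in>{m. partitions I S m \<noteq> {}}. enat m)"

definition min_edge_paths :: "'w vrpsd_data \<Rightarrow> nat set \<Rightarrow> nat set set \<Rightarrow> enat" where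
  "min_edge_paths I S ES = (INF m\<in>{m. edge_partitions I S ES m \<noteq> {}}. enat m)"

definition opt_cost :: "'w vrpsd_data \<Rightarrow> nat set \<Rightarrow> nat \<Rightarrow> ereal" where
  "opt_cost I S m = (INF \<pi>\<in>partitions I S m. ereal (\<Sum>p\<in>\<pi>. or_cost I p))"

definition edge_opt_cost :: "'w vrpsd_data \<Rightarrow> nat set \<Rightarrow> nat set set \<Rightarrow> nat \<Rightarrow> ereal" where
  "edge_opt_cost I S ES m = (INF \<pi>\<in>edge_partitions I S ES m. ereal (\<Sum>p\<in>\<pi>. or_cost I p))"

definition valid_S_coeff :: "'w vrpsd_data \<Rightarrow> nat set \<Rightarrow> nat \<Rightarrow> ereal \<Rightarrow> bool" where
  "valid_S_coeff I S m L \<longleftrightarrow> L \<le> opt_cost I S m"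

definition valid_E_coeff ::
    "'w vrpsd_data \<Rightarrow> nat set \<Rightarrow> nat set set \<Rightarrow> nat \<Rightarrow> ereal \<Rightarrow> bool" where
  "valid_E_coeff I S ES m L \<longleftrightarrow> L \<le> edge_opt_cost I S ES m"

text \<open>The library's \<open>poisson_pmf\<close> is meant for positive rates; the rate 0 gives the point
  mass at 0.\<close>

definition poisson_law :: "real \<Rightarrow> nat pmf" where
  "poisson_law r = (if r = 0 then return_pmf 0 else poisson_pmf r)"

definition poisson_demand :: "'w vrpsd_data \<Rightarrow> nat \<Rightarrow> bool" where
  "poisson_demand I i \<longleftrightarrow>
     distr (dem_space I) (count_space UNIV) (demand I i) = measure_pmf (poisson_law (mean_dem I i))"

text \<open>Below, \<open>ix\<close> is an indexing of \<open>S\<close> by \<open>{1..card S}\<close> and \<open>mu\<close> is the common unit of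
  the means.\<close>

definition cF_from :: "'w vrpsd_data \<Rightarrow> nat set \<Rightarrow> (nat \<Rightarrow> nat) \<Rightarrow> nat \<Rightarrow> real" where
  "cF_from I S ix k = (MIN j\<in>{k..card S}. cF I (ix j))"

definition cP_from ::
    "'w vrpsd_data \<Rightarrow> nat set \<Rightarrow> nat set set \<Rightarrow> (nat \<Rightarrow> nat) \<Rightarrow> nat \<Rightarrow> ereal" where
  "cP_from I S ES ix k =
     (INF (j, l)\<in>{(j, l). j \<in> {k..card S} \<and> l \<in> {k..card S} \<and> {ix j, ix l} \<in> ES}.
        ereal (cP I (ix j) (ix l)))"

definition tilde_H ::
    "nat \<Rightarrow> real \<Rightarrow> real \<Rightarrow> (nat \<Rightarrow> ereal) \<Rightarrow> nat \<Rightarrow> ereal" where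
  "tilde_H Q mu a G q =
     (\<Sum>s. (ereal (a * real (Psi Q s q)) + G (residual Q s q)) * ereal (pmf (poisson_pmf mu) s))"

primrec tilde_F ::
    "nat \<Rightarrow> real \<Rightarrow> real \<Rightarrow> ereal \<Rightarrow> nat \<Rightarrow> nat \<Rightarrow> ereal" where
  "tilde_F Q mu a b 0 = (\<lambda>q. 0)"
| "tilde_F Q mu a b (Suc d) =
     (\<lambda>q. min (tilde_H Q mu a (tilde_F Q mu a b d) q)
              (b + tilde_H Q mu a (tilde_F Q mu a b d) Q))"

text \<open>\<open>tilde_g I S ES ix mu k d\<close> is the value of the \<open>k\<close>-th bounding function at load
  \<open>d * mu\<close>.\<close>

definition tilde_g ::
    "'w vrpsd_data \<Rightarrow> nat set \<Rightarrow> nat set set \<Rightarrow> (nat \<Rightarrow> nat) \<Rightarrow> real \<Rightarrow> nat \<Rightarrow> nat \<Rightarrow> ereal" where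
  "tilde_g I S ES ix mu k d =
     tilde_F (capacity I) mu (cF_from I S ix k) (cP_from I S ES ix k) d (capacity I)"

definition units_total :: "'w vrpsd_data \<Rightarrow> nat set \<Rightarrow> real \<Rightarrow> real" where
  "units_total I S mu = (\<Sum>i\<in>S. mean_dem I i) / mu"

definition units_max :: "'w vrpsd_data \<Rightarrow> real \<Rightarrow> nat" where
  "units_max I mu = nat \<lfloor>load_factor I * real (capacity I) / mu\<rfloor>"

definition assignments ::
    "'w vrpsd_data \<Rightarrow> nat set \<Rightarrow> real \<Rightarrow> nat \<Rightarrow> (nat \<Rightarrow> nat \<Rightarrow> real) set" where
  "assignments I S mu m =
     {y. (\<forall>k\<in>{1..m}. \<forall>l\<in>{0..units_max I mu}. y k l \<in> {0, 1}) \<and>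
         (\<forall>k\<in>{1..m}. (\<Sum>l=0..units_max I mu. y k l) = 1) \<and>
         (\<Sum>k=1..m. \<Sum>l=0..units_max I mu. real l * y k l) = units_total I S mu}"

definition L2 ::
    "'w vrpsd_data \<Rightarrow> nat set \<Rightarrow> nat set set \<Rightarrow> nat \<Rightarrow> (nat \<Rightarrow> nat) \<Rightarrow> real \<Rightarrow> ereal" where
  "L2 I S ES m ix mu =
     (INF y\<in>assignments I S mu m.
        \<Sum>k=1..m. \<Sum>l=0..units_max I mu. tilde_g I S ES ix mu k l * ereal (y k l))"

end

theory Submission
  imports Defs
begin

text \<open>Order the paths of a partition by the smallest index of their customers. The \<open>k\<close>-th path
  then uses only customers of index at least \<open>k\<close>, so its costs dominate \<open>c\<^sup>F\<^sub>(\<^sub>k\<^sub>)\<close> and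
  \<open>c\<^sup>P\<^sub>(\<^sub>k\<^sub>)\<close>. Replacing each customer of mean \<open>n * mu\<close> by \<open>n\<close> customers of mean \<open>mu\<close> leaves the
  total demand Poisson and only adds restocking opportunities; hence the \<open>k\<close>-th bounding function
  at the load of the \<open>k\<close>-th path is at most the cost of that path, in either direction, and the
  loads of the paths form a feasible assignment.\<close>

section \<open>Replenishment counts\<close>

text \<open>\<open>Psi\<close> is the least number of refills covering the demand; the facts below
  use this form in place of the ceiling.\<close>

lemma Psi_le_iff:
  assumes "0 < Q"
  shows "Psi Q s q \<le> k \<longleftrightarrow> s \<le> k * Q + q"
proof -
  have "Psi Q s q \<le> k \<longleftrightarrow> \<lceil>(real s - real q) / real Q\<rceil> \<le> int k"
    unfolding Psi_def by linarith
  also have "\<dots> \<longleftrightarrow> real s - real q \<le> real k * real Q"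
    using assms by (simp add: ceiling_le_iff pos_divide_le_eq)
  also have "\<dots> \<longleftrightarrow> real s \<le> real (k * Q + q)" by auto
  also have "\<dots> \<longleftrightarrow> s \<le> k * Q + q" by (simp only: of_nat_le_iff)
  finally show ?thesis .
qed

lemma Psi_le_demand:
  assumes "0 < Q"
  shows "Psi Q s q \<le> s"
proof -
  have "s * 1 \<le> s * Q" using assms by (intro mult_left_mono) auto
  then have "s \<le> s * Q + q" by linarith
  then show ?thesis using assms by (simp only: Psi_le_iff)
qed

lemma Psi_zero [simp]: "0 < Q \<Longrightarrow> Psi Q 0 q = 0"
  using Psi_le_iff[of Q 0 q 0] by simp

lemma residual_zero [simp]: "0 < Q \<Longrightarrow> residual Q 0 q = q"
  by (simp add: residual_def)

lemma residual_plus_demand: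
  assumes "0 < Q"
  shows "residual Q s q + s = Psi Q s q * Q + q"
  using Psi_le_iff[OF assms, of s q "Psi Q s q"] by (simp add: residual_def)

text \<open>With one refill fewer the demand would not be met, so after any refill less than
  \<open>Q\<close> is left; without refills the load is at most \<open>q\<close>.\<close>

lemma residual_le:
  assumes "0 < Q"
  shows "residual Q s q \<le> max q Q"
proof (cases "Psi Q s q")
  case 0
  then show ?thesis by (simp add: residual_def)
next
  case (Suc k)
  then have "k * Q + q < s" using Psi_le_iff[OF assms, of s q k] by simp
  with Suc show ?thesis by (simp add: residual_def)
qed

text \<open>Pathwise core of the splitting argument: meeting a demand in two portions does not
  change the refill count. The two counts have the same upper bounds.\<close>

lemma Psi_add:
  assumes "0 < Q"
  shows "Psi Q (s + t) q = Psi Q s q + Psi Q t (residual Q s q)"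
proof -
  define k where "k = Psi Q s q"
  define r where "r = residual Q s q"
  have r: "r + s = k * Q + q"
    using residual_plus_demand[OF assms] by (simp add: k_def r_def)
  have iff: "Psi Q (s + t) q \<le> k + j \<longleftrightarrow> Psi Q t r \<le> j" for j
    using r assms by (simp add: Psi_le_iff algebra_simps) linarith
  \<comment> \<open>\<open>iff\<close> only tests bounds of the form \<open>k + j\<close>, so the
    total count must first be shown to be at least \<open>k\<close>.\<close>
  have "s \<le> Psi Q (s + t) q * Q + q"
    using Psi_le_iff[OF assms, of "s + t" q "Psi Q (s + t) q"] by simp
  then have "k \<le> Psi Q (s + t) q"
    unfolding k_def using assms by (simp add: Psi_le_iff)
  then obtain j where j: "Psi Q (s + t) q = k + j" using le_Suc_ex by blast
  have "Psi Q t r \<le> j" using iff[of j] j by simp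
  moreover have "j \<le> Psi Q t r" using iff[of "Psi Q t r"] j by simp
  ultimately show ?thesis using j by (simp add: k_def r_def)
qed

lemma residual_add:
  assumes "0 < Q"
  shows "residual Q (s + t) q = residual Q t (residual Q s q)"
  using residual_plus_demand[OF assms, of "s + t" q] residual_plus_demand[OF assms, of s q]
    residual_plus_demand[OF assms, of t "residual Q s q"] Psi_add[OF assms, of s t q]
  by (simp add: algebra_simps)

section \<open>Poisson convolution\<close>

lemma pmf_map_add:
  fixes p :: "nat pmf"
  shows "pmf (map_pmf ((+) s) p) n = (if s \<le> n then pmf p (n - s) else 0)"
proof (cases "s \<le> n")
  case True
  then have "pmf (map_pmf ((+) s) p) (s + (n - s)) = pmf p (n - s)"
    by (intro pmf_map_inj') auto
  with True show ?thesis by simp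
next
  case False
  then show ?thesis by (auto intro!: pmf_map_outside)
qed

text \<open>After \<open>exp (- (a + b)) / fact n\<close> is factored out, the convolution sum is
  the binomial expansion of \<open>(a + b) ^ n\<close>.\<close>

lemma poisson_pmf_add:
  assumes "0 < a" "0 < b"
  shows "poisson_pmf (a + b) =
    bind_pmf (poisson_pmf a) (\<lambda>s. map_pmf ((+) s) (poisson_pmf b))" (is "_ = ?B")
proof (rule pmf_eqI)
  fix n
  have ab: "0 < a + b" using assms by simp
  have "pmf ?B n = (\<Sum>s\<le>n. pmf (map_pmf ((+) s) (poisson_pmf b)) n * pmf (poisson_pmf a) s)"
    unfolding pmf_bind
    by (rule integral_measure_pmf_real) (auto simp: pmf_map_add split: if_splits)
  also have "\<dots> = (\<Sum>s\<le>n. of_nat (n choose s) * a ^ s * b ^ (n - s) * (exp (- (a + b)) / fact n))"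
    using assms by (intro sum.cong)
      (auto simp: pmf_map_add binomial_fact exp_add[symmetric] exp_minus field_simps)
  also have "\<dots> = (a + b) ^ n * (exp (- (a + b)) / fact n)"
    by (simp only: binomial_ring sum_distrib_right)
  also have "\<dots> = pmf (poisson_pmf (a + b)) n" using ab by simp
  finally show "pmf (poisson_pmf (a + b)) n = pmf ?B n" by simp
qed

text \<open>At rate 0 the law is the point mass at 0, the neutral element of convolution.\<close>

lemma poisson_law_add:
  assumes "0 \<le> a" "0 \<le> b"
  shows "poisson_law (a + b) =
    bind_pmf (poisson_law a) (\<lambda>s. map_pmf ((+) s) (poisson_law b))"
proof (cases "a = 0 \<or> b = 0")
  case True
  have "map_pmf ((+) (0::nat)) p = p" for p by (simp add: map_pmf_def bind_return_pmf')
  with True show ?thesis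
    by (auto simp: poisson_law_def bind_return_pmf bind_return_pmf')
next
  case False
  then show ?thesis using assms poisson_pmf_add[of a b] by (auto simp: poisson_law_def)
qed

section \<open>The recursions over the extended non-negative reals\<close>

text \<open>Common form of \<open>or_H\<close> and \<open>tilde_H\<close>. In
  \<open>ennreal\<close>, monotonicity and additivity of the integral hold without integrability,
  and an infinite restocking cost is allowed.\<close>

definition step :: "nat \<Rightarrow> nat pmf \<Rightarrow> ennreal \<Rightarrow> (nat \<Rightarrow> ennreal) \<Rightarrow> nat \<Rightarrow> ennreal" where
  "step Q p a G q = (\<integral>\<^sup>+s. a * of_nat (Psi Q s q) + G (residual Q s q) \<partial>measure_pmf p)"

lemma step_mono:
  assumes "a \<le> a'" "\<And>s. G (residual Q s q) \<le> G' (residual Q s q)"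
  shows "step Q p a G q \<le> step Q p a' G' q"
  unfolding step_def by (intro nn_integral_mono add_mono mult_right_mono assms) auto

lemma step_return: "0 < Q \<Longrightarrow> step Q (return_pmf 0) a G q = G q"
  by (simp add: step_def)

text \<open>\<open>Psi_add\<close> and \<open>residual_add\<close> split the integrand; the refill
  cost of the first portion is constant in the second and integrates to itself because
  \<open>p'\<close> has total mass 1.\<close>

lemma step_bind:
  assumes "0 < Q"
  shows "step Q (bind_pmf p (\<lambda>s. map_pmf ((+) s) p')) a G q = step Q p a (step Q p' a G) q"
  unfolding step_def using assms
  by (simp add: Psi_add residual_add distrib_left add.assoc nn_integral_add
      measure_pmf.emeasure_space_1)

primrec unit_F :: "nat \<Rightarrow> nat pmf \<Rightarrow> ennreal \<Rightarrow> ennreal \<Rightarrow> nat \<Rightarrow> nat \<Rightarrow> ennreal" where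
  "unit_F Q p a b 0 = (\<lambda>q. 0)"
| "unit_F Q p a b (Suc d) =
     (\<lambda>q. min (step Q p a (unit_F Q p a b d) q) (b + step Q p a (unit_F Q p a b d) Q))"

text \<open>At full load the two branches are some \<open>x\<close> and \<open>b + x\<close>, with
  minimum \<open>x\<close>; so for positive \<open>d\<close> the right-hand side is the restocking
  branch at \<open>q\<close>.\<close>

lemma unit_F_le_restock: "unit_F Q p a b d q \<le> b + unit_F Q p a b d Q"
  by (cases d) (auto simp: min_def add_increasing)

lemma tilde_H_eq_step:
  assumes "0 \<le> a"
  shows "tilde_H Q mu a (\<lambda>q. enn2ereal (G q)) q = enn2ereal (step Q (poisson_pmf mu) (ennreal a) G q)"
proof -
  have "tilde_H Q mu a (\<lambda>q. enn2ereal (G q)) q =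
      (\<Sum>s. enn2ereal ((ennreal a * of_nat (Psi Q s q) + G (residual Q s q)) *
        ennreal (pmf (poisson_pmf mu) s)))"
    unfolding tilde_H_def
    using assms by (simp add: plus_ennreal.rep_eq times_ennreal.rep_eq)
  also have "\<dots> = enn2ereal (\<Sum>s. (ennreal a * of_nat (Psi Q s q) + G (residual Q s q)) *
        ennreal (pmf (poisson_pmf mu) s))"
    by simp
  also have "(\<Sum>s. (ennreal a * of_nat (Psi Q s q) + G (residual Q s q)) *
        ennreal (pmf (poisson_pmf mu) s)) = step Q (poisson_pmf mu) (ennreal a) G q"
    by (simp add: step_def nn_integral_measure_pmf nn_integral_count_space_nat mult.commute)
  finally show ?thesis .
qed

lemma enn2ereal_min: "enn2ereal (min x y) = min (enn2ereal x) (enn2ereal y)"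
  by (simp add: min_def less_eq_ennreal.rep_eq)

text \<open>Since \<open>0 \<le> b\<close>, \<open>e2ennreal b\<close> loses nothing, even for
  \<open>b = \<infinity>\<close>, the value of \<open>cP_from\<close> when no edge is
  available.\<close>

lemma tilde_F_eq_unit_F:
  assumes "0 \<le> a" "0 \<le> b"
  shows "tilde_F Q mu a b d =
    (\<lambda>q. enn2ereal (unit_F Q (poisson_pmf mu) (ennreal a) (e2ennreal b) d q))"
proof (induction d)
  case (Suc d)
  then show ?case
    using assms
    by (simp add: tilde_H_eq_step enn2ereal_min plus_ennreal.rep_eq enn2ereal_e2ennreal)
qed (simp add: zero_ennreal.rep_eq)

text \<open>Splitting a demand of \<open>n\<close> units into \<open>n\<close> customers of one unit each only adds
  restocking opportunities.\<close>

lemma unit_F_add_le_step: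
  assumes "0 < Q" "0 < mu"
  shows "unit_F Q (poisson_pmf mu) a b (n + d) q \<le>
    step Q (poisson_law (real n * mu)) a (unit_F Q (poisson_pmf mu) a b d) q"
proof (induction n arbitrary: q)
  case 0
  then show ?case using assms by (simp add: poisson_law_def step_return)
next
  case (Suc n)
  let ?F = "unit_F Q (poisson_pmf mu) a b"
  \<comment> \<open>The first unit is peeled off; as \<open>mu\<close> is positive, its law is
    \<open>poisson_pmf mu\<close>.\<close>
  have "poisson_law (real (Suc n) * mu) =
      bind_pmf (poisson_pmf mu) (\<lambda>s. map_pmf ((+) s) (poisson_law (real n * mu)))"
    using poisson_law_add[of mu "real n * mu"] assms
    by (simp add: poisson_law_def[of mu] algebra_simps)
  then have "step Q (poisson_law (real (Suc n) * mu)) a (?F d) q =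
      step Q (poisson_pmf mu) a (step Q (poisson_law (real n * mu)) a (?F d)) q"
    using assms by (simp add: step_bind)
  also have "\<dots> \<ge> step Q (poisson_pmf mu) a (?F (n + d)) q"
    by (intro step_mono Suc.IH order_refl)
  \<comment> \<open>Proceeding to the next unit without restocking is one branch of the
    minimum.\<close>
  finally show ?case by (simp add: min.coboundedI1)
qed

section \<open>Comparison along a path\<close>

context vrpsd
begin

lemma cF_nonneg:
  assumes "i \<in> customers I"
  shows "0 \<le> cF I i"
proof -
  have "0 \<noteq> i" using assms by (auto simp: customers_def)
  then show ?thesis
    using cost_nonneg[of 0 i] assms pen_P_nonneg pen_P_le_pen_F by (simp add: cF_def)
qed

text \<open>For customers this is the triangle inequality for the detour through the depot.\<close>

lemma cP_nonneg:
  assumes "i \<in> insert 0 (customers I)" "j \<in> customers I" "i \<noteq> j"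
  shows "0 \<le> cP I i j"
proof (cases "i = 0")
  case False
  then show ?thesis
    using assms cost_triangle[of i 0 j] cost_sym[of i 0] pen_P_nonneg
    by (auto simp: cP_def customers_def)
qed (simp add: cP_def pen_P_nonneg)

lemma or_H_nonneg:
  assumes "i \<in> customers I" "\<And>q. 0 \<le> G q"
  shows "0 \<le> or_H I i G q"
  unfolding or_H_def
  by (intro integral_nonneg_AE AE_I2 add_nonneg_nonneg mult_nonneg_nonneg cF_nonneg assms) auto

text \<open>Distinctness makes consecutive vertices differ, so that \<open>cP_nonneg\<close> applies
  along the whole path.\<close>

lemma or_F_nonneg:
  assumes "distinct (i # p)" "i \<in> insert 0 (customers I)" "set p \<subseteq> customers I"
  shows "0 \<le> or_F I i p q"
  using assms
proof (induction p arbitrary: i q)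
  case (Cons j p)
  then have "0 \<le> or_H I j (or_F I j p) q" for q by (intro or_H_nonneg) auto
  moreover have "0 \<le> cP I i j" using Cons.prems by (intro cP_nonneg) auto
  ultimately show ?case by simp
qed simp

text \<open>The Bochner integral in \<open>or_H\<close> agrees with the nonnegative integral once
  the integrand is integrable; this follows from the finite mean of the demand.\<close>

lemma or_H_eq_step:
  assumes i: "i \<in> customers I" and law: "distr (dem_space I) (count_space UNIV) (demand I i) = measure_pmf p"
    and G: "\<And>q. 0 \<le> G q"
  shows "ennreal (or_H I i G q) =
    step (capacity I) p (ennreal (cF I i)) (\<lambda>r. ennreal (G r)) q"
proof -
  let ?Q = "capacity I"
  define f where "f s = cF I i * real (Psi ?Q s q) + G (residual ?Q s q)" for s
  have [measurable]: "demand I i \<in> measurable (dem_space I) (count_space UNIV)"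
    using demand_indep i by (auto simp: indep_vars_def)
  have f_nonneg: "0 \<le> f s" for s
    unfolding f_def using cF_nonneg[OF i] G by simp
  \<comment> \<open>\<open>G\<close> may be unbounded, but by \<open>residual_le\<close> only
    finitely many loads are reachable from \<open>q\<close>.\<close>
  define M where "M = Max (G ` {..max q ?Q})"
  have f_le: "f s \<le> cF I i * real s + M" for s
    unfolding f_def M_def using cF_nonneg[OF i] Psi_le_demand[OF capacity_pos]
      residual_le[OF capacity_pos]
    by (intro add_mono mult_left_mono Max_ge) auto
  have "integrable (dem_space I) (\<lambda>\<omega>. f (demand I i \<omega>))"
  proof (rule Bochner_Integration.integrable_bound)
    show "integrable (dem_space I) (\<lambda>\<omega>. cF I i * real (demand I i \<omega>) + M)"
      using demand_integrable[OF i] by simp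
    show "AE \<omega> in dem_space I. norm (f (demand I i \<omega>)) \<le> norm (cF I i * real (demand I i \<omega>) + M)"
      using f_le f_nonneg by (intro AE_I2) (auto intro: order_trans[OF _ abs_ge_self])
  qed measurable
  then have "ennreal (or_H I i G q) = (\<integral>\<^sup>+\<omega>. ennreal (f (demand I i \<omega>)) \<partial>dem_space I)"
    unfolding or_H_def f_def[symmetric] using f_nonneg
    by (intro nn_integral_eq_integral[symmetric]) auto
  also have "\<dots> = (\<integral>\<^sup>+s. ennreal (f s) \<partial>distr (dem_space I) (count_space UNIV) (demand I i))"
    by (subst nn_integral_distr) auto
  also have "\<dots> = (\<integral>\<^sup>+s. ennreal (f s) \<partial>measure_pmf p)" by (simp only: law)
  also have "\<dots> = step ?Q p (ennreal (cF I i)) (\<lambda>r. ennreal (G r)) q"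
    unfolding step_def f_def using cF_nonneg[OF i] G
    by (simp add: ennreal_mult ennreal_of_nat_eq_real_of_nat)
  finally show ?thesis .
qed

text \<open>One customer of the path: its \<open>n\<close> units are merged into a single stage,
  then the unit cost and the cost-to-go are raised to those of the customer.\<close>

lemma unit_F_le_or_H:
  assumes "j \<in> customers I" "poisson_demand I j" "mean_dem I j = real n * mu" "0 < mu"
    and "a \<le> ennreal (cF I j)" "\<And>q. 0 \<le> G q"
    and G: "\<And>q. unit_F (capacity I) (poisson_pmf mu) a b d q \<le> ennreal (G q)"
  shows "unit_F (capacity I) (poisson_pmf mu) a b (n + d) q \<le> ennreal (or_H I j G q)"
proof -
  have "unit_F (capacity I) (poisson_pmf mu) a b (n + d) q \<le>
      step (capacity I) (poisson_law (real n * mu)) a (unit_F (capacity I) (poisson_pmf mu) a b d) q"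
    using capacity_pos assms by (intro unit_F_add_le_step) auto
  also have "\<dots> \<le> step (capacity I) (poisson_law (real n * mu)) (ennreal (cF I j)) (\<lambda>r. ennreal (G r)) q"
    by (intro step_mono assms)
  also have "\<dots> = ennreal (or_H I j G q)"
    using assms by (intro or_H_eq_step[symmetric]) (auto simp: poisson_demand_def)
  finally show ?thesis .
qed

lemma unit_F_le_or_F:
  assumes "0 < mu" "distinct (i # p)" "i \<in> insert 0 (customers I)" "set p \<subseteq> customers I"
    and "\<And>j. j \<in> set p \<Longrightarrow> poisson_demand I j"
    and "\<And>j. j \<in> set p \<Longrightarrow> mean_dem I j = real (u j) * mu"
    and "\<And>j. j \<in> set p \<Longrightarrow> a \<le> ennreal (cF I j)"
    and "successively (\<lambda>j l. b \<le> ennreal (cP I j l)) (i # p)"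
  shows "unit_F (capacity I) (poisson_pmf mu) a b (\<Sum>j\<leftarrow>p. u j) q \<le> ennreal (or_F I i p q)"
  using assms(2-)
proof (induction p arbitrary: i q)
  case (Cons j p)
  let ?F = "unit_F (capacity I) (poisson_pmf mu) a b" and ?H = "or_H I j (or_F I j p)"
  let ?n = "u j + (\<Sum>j\<leftarrow>p. u j)"
  have H: "?F ?n q \<le> ennreal (?H q)" for q
    using Cons.prems assms(1)
    by (intro unit_F_le_or_H or_F_nonneg Cons.IH) auto
  \<comment> \<open>Restocking before customer \<open>j\<close> is matched by restocking before the
    first of its units.\<close>
  have "?F ?n q \<le> b + ?F ?n (capacity I)" by (rule unit_F_le_restock)
  also have "\<dots> \<le> ennreal (cP I i j) + ennreal (?H (capacity I))"
    using Cons.prems(7) by (intro add_mono H) simp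
  also have "\<dots> = ennreal (cP I i j + ?H (capacity I))"
    using Cons.prems by (intro ennreal_plus[symmetric] cP_nonneg or_H_nonneg or_F_nonneg) auto
  finally show ?case using H[of q] by (simp add: min_def)
qed simp

text \<open>The load is full when leaving the depot, so restocking there is never cheaper and the
  depot needs no bound on its restocking cost.\<close>

lemma unit_F_le_or_F_depot:
  assumes "0 < mu" "distinct p" "set p \<subseteq> customers I"
    and "\<And>j. j \<in> set p \<Longrightarrow> poisson_demand I j"
    and "\<And>j. j \<in> set p \<Longrightarrow> mean_dem I j = real (u j) * mu"
    and "\<And>j. j \<in> set p \<Longrightarrow> a \<le> ennreal (cF I j)"
    and "successively (\<lambda>j l. b \<le> ennreal (cP I j l)) p"
  shows "unit_F (capacity I) (poisson_pmf mu) a b (\<Sum>j\<leftarrow>p. u j) (capacity I) \<le>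
    ennreal (or_F I 0 p (capacity I))"
proof (cases p)
  case (Cons j p')
  have "unit_F (capacity I) (poisson_pmf mu) a b (\<Sum>j\<leftarrow>p. u j) (capacity I) \<le>
      ennreal (or_H I j (or_F I j p') (capacity I))"
    unfolding Cons list.map sum_list.Cons
    using assms unfolding Cons
    by (intro unit_F_le_or_H unit_F_le_or_F or_F_nonneg) auto
  then show ?thesis using Cons pen_P_nonneg by (simp add: cP_def min_def)
qed simp

text \<open>The bound depends on the path only through its total units and its undirected edges,
  which reversal preserves, so it holds for both directions.\<close>

lemma tilde_F_le_or_cost:
  assumes "0 < mu" "feasible_path I p"
    and "\<And>j. j \<in> set p \<Longrightarrow> poisson_demand I j"
    and "\<And>j. j \<in> set p \<Longrightarrow> mean_dem I j = real (u j) * mu"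
    and "0 \<le> a" "0 \<le> b" and "\<And>j. j \<in> set p \<Longrightarrow> a \<le> cF I j"
    and b: "\<And>j l. {j, l} \<in> path_edges p \<Longrightarrow> b \<le> ereal (cP I j l)"
  shows "tilde_F (capacity I) mu a b (\<Sum>j\<in>set p. u j) (capacity I) \<le> ereal (or_cost I p)"
proof -
  have p: "distinct p" "set p \<subseteq> customers I" using assms by (auto simp: feasible_path_def)
  then have "0 \<notin> set p" by (auto simp: customers_def)
  have succ: "successively (\<lambda>j l. {j, l} \<in> path_edges p) p"
    by (auto simp: successively_conv_nth path_edges_def)
  have succ_rev: "successively (\<lambda>j l. {j, l} \<in> path_edges p) (rev p)"
    using succ by (simp add: successively_rev insert_commute)
  have *: "tilde_F (capacity I) mu a b (\<Sum>j\<in>set p. u j) (capacity I) \<le> ereal (or_F I 0 p' (capacity I))"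
    if p': "distinct p'" "set p' = set p" "successively (\<lambda>j l. {j, l} \<in> path_edges p) p'" for p'
  proof -
    have "successively (\<lambda>j l. e2ennreal b \<le> ennreal (cP I j l)) p'"
      using p'(3) by (rule successively_mono) (auto dest!: b e2ennreal_mono)
    then have "unit_F (capacity I) (poisson_pmf mu) (ennreal a) (e2ennreal b) (\<Sum>j\<leftarrow>p'. u j) (capacity I) \<le>
        ennreal (or_F I 0 p' (capacity I))"
      using assms p' p by (intro unit_F_le_or_F_depot ennreal_leI) auto
    moreover have "0 \<le> or_F I 0 p' (capacity I)"
      using p p' \<open>0 \<notin> set p\<close> by (intro or_F_nonneg) auto
    ultimately show ?thesis
      using p' assms
      by (simp add: tilde_F_eq_unit_F less_eq_ennreal.rep_eq sum_list_distinct_conv_sum_set)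
  qed
  show ?thesis
    unfolding or_cost_def using *[of p] *[of "rev p"] p succ succ_rev by (simp add: min_def)
qed

end

section \<open>Indexing the paths of a partition\<close>

text \<open>In increasing order, distinct positive integers are at least their rank. The induction
  places a maximiser of \<open>f\<close> last.\<close>

lemma ex_bij_betw_le:
  fixes f :: "'a \<Rightarrow> nat"
  assumes "finite A" "inj_on f A" "\<And>x. x \<in> A \<Longrightarrow> 1 \<le> f x"
  shows "\<exists>\<sigma>. bij_betw \<sigma> {1..card A} A \<and> (\<forall>k\<in>{1..card A}. k \<le> f (\<sigma> k))"
  using assms
proof (induction "card A" arbitrary: A)
  case 0
  then show ?case by (auto simp: bij_betw_def)
next
  case (Suc n)
  then have "A \<noteq> {}" by auto
  then obtain x where x: "x \<in> A" "f x = Max (f ` A)"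
    using Max_in[of "f ` A"] Suc.prems(1) by fastforce
  then have "f y \<le> f x" if "y \<in> A" for y using Suc.prems(1) that by simp
  \<comment> \<open>\<open>f\<close> maps \<open>A\<close> injectively into \<open>{1..f x}\<close>,
    so the maximum is at least the last rank.\<close>
  have "card A \<le> card {1..f x}"
    using Suc.prems \<open>\<And>y. y \<in> A \<Longrightarrow> f y \<le> f x\<close> by (intro card_inj_on_le[of f]) auto
  then have fx: "Suc n \<le> f x" using Suc.hyps by simp
  have n: "card (A - {x}) = n" using Suc.hyps(2) Suc.prems x by simp
  obtain \<sigma> where \<sigma>: "bij_betw \<sigma> {1..n} (A - {x})" "\<And>k. k \<in> {1..n} \<Longrightarrow> k \<le> f (\<sigma> k)"
    using Suc.hyps(1)[of "A - {x}"] Suc.prems n inj_on_subset[of f A "A - {x}"] by auto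
  have "bij_betw (\<sigma>(Suc n := x)) {1..n} (A - {x})"
    using \<sigma>(1) by (subst bij_betw_cong[of _ _ \<sigma>]) auto
  then have "bij_betw (\<sigma>(Suc n := x)) ({1..n} \<union> {Suc n}) ((A - {x}) \<union> {x})"
    by (intro bij_betw_combine) (auto simp: bij_betw_def)
  moreover have "{1..n} \<union> {Suc n} = {1..Suc n}" by auto
  moreover have "(A - {x}) \<union> {x} = A" using x by auto
  ultimately have "bij_betw (\<sigma>(Suc n := x)) {1..card A} A" using Suc.hyps(2) by simp
  moreover have "\<forall>k\<in>{1..card A}. k \<le> f ((\<sigma>(Suc n := x)) k)"
    using \<sigma>(2) fx Suc.hyps(2) by (auto simp: le_Suc_eq)
  ultimately show ?case by blast
qed

text \<open>Paths repeat no customer, so consecutive entries always form an edge inside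
  \<open>S\<close>. This makes the S-cut a special case of the E-cut.\<close>

lemma edge_partitions_edges_within:
  "edge_partitions I S (edges_within S) m = partitions I S m"
proof -
  have "path_edges p \<subseteq> edges_within S" if "\<pi> \<in> partitions I S m" "p \<in> \<pi>" for \<pi> p
  proof -
    have "distinct p" "set p \<subseteq> S"
      using that by (auto simp: partitions_def feasible_path_def)
    then show ?thesis
      by (fastforce simp: path_edges_def edges_within_def nth_eq_iff_index_eq
          intro: nth_mem Suc_lessD)
  qed
  then show ?thesis by (auto simp: edge_partitions_def)
qed

section \<open>From a partition to a feasible assignment\<close>

context vrpsd
begin

lemma L2_le_edge_partition:
  assumes S: "S \<subseteq> customers I" and pois: "\<And>i. i \<in> S \<Longrightarrow> poisson_demand I i"
    and ix: "bij_betw ix {1..card S} S" and mu: "0 < mu"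
    and u: "\<And>i. i \<in> S \<Longrightarrow> mean_dem I i = real (u i) * mu"
    and ES: "ES \<subseteq> edges_within S" and \<pi>: "\<pi> \<in> edge_partitions I S ES m"
  shows "L2 I S ES m ix mu \<le> ereal (\<Sum>p\<in>\<pi>. or_cost I p)"
proof -
  have \<pi>': "finite \<pi>" "card \<pi> = m" "\<And>p. p \<in> \<pi> \<Longrightarrow> feasible_path I p"
      "disjoint_family_on set \<pi>" "(\<Union>p\<in>\<pi>. set p) = S" "\<And>p. p \<in> \<pi> \<Longrightarrow> path_edges p \<subseteq> ES"
    using \<pi> by (auto simp: edge_partitions_def partitions_def)
  have ne: "set p \<noteq> {}" if "p \<in> \<pi>" for p using \<pi>'(3)[OF that] by (auto simp: feasible_path_def)
  define pos where "pos = inv_into {1..card S} ix"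
  have pos: "pos i \<in> {1..card S}" "ix (pos i) = i" if "i \<in> S" for i
    using ix that bij_betw_inv_into_right[OF ix that] bij_betwE[OF bij_betw_inv_into[OF ix]]
    by (auto simp: pos_def)
  define first where "first p = Min (pos ` set p)" for p
  have first: "\<exists>i\<in>set p. first p = pos i" if "p \<in> \<pi>" for p
  proof -
    have "first p \<in> pos ` set p" unfolding first_def using ne[OF that] by (intro Min_in) auto
    then show ?thesis by blast
  qed
  \<comment> \<open>Each smallest index identifies a customer, and disjoint paths share
    none.\<close>
  have inj: "inj_on first \<pi>"
  proof (rule inj_onI)
    fix p p' assume p: "p \<in> \<pi>" "p' \<in> \<pi>" "first p = first p'"
    then obtain i i' where i: "i \<in> set p" "i' \<in> set p'" "pos i = pos i'" using first by metis
    then have "i = i'" using pos(2) p \<pi>'(5) by (metis UN_I)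
    then show "p = p'" using i p \<pi>'(4) by (auto simp: disjoint_family_on_def)
  qed
  have "\<exists>\<sigma>. bij_betw \<sigma> {1..card \<pi>} \<pi> \<and> (\<forall>k\<in>{1..card \<pi>}. k \<le> first (\<sigma> k))"
  proof (rule ex_bij_betw_le[OF \<pi>'(1) inj])
    fix p assume "p \<in> \<pi>"
    then show "1 \<le> first p" using first[of p] pos(1) \<pi>'(5) by fastforce
  qed
  then obtain \<sigma> where \<sigma>: "bij_betw \<sigma> {1..m} \<pi>" "\<And>k. k \<in> {1..m} \<Longrightarrow> k \<le> first (\<sigma> k)"
    using \<pi>'(2) by blast
  have \<sigma>_in: "\<sigma> k \<in> \<pi>" if "k \<in> {1..m}" for k using bij_betwE[OF \<sigma>(1)] that by blast
  have pos_ge: "k \<le> pos i" if "k \<in> {1..m}" "i \<in> set (\<sigma> k)" for k i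
  proof -
    have "first (\<sigma> k) \<le> pos i" using that by (auto simp: first_def)
    then show ?thesis using \<sigma>(2) that by fastforce
  qed
  define D where "D k = (\<Sum>i\<in>set (\<sigma> k). u i)" for k
  have sub: "set (\<sigma> k) \<subseteq> S" if "k \<in> {1..m}" for k using \<sigma>_in[OF that] \<pi>'(5) by blast
  \<comment> \<open>Path feasibility puts the load of each path among the levels of the assignment
    problem.\<close>
  have D_le: "D k \<le> units_max I mu" if k: "k \<in> {1..m}" for k
  proof -
    have "(\<Sum>i\<in>set (\<sigma> k). mean_dem I i) = real (D k) * mu"
      using sub[OF k] u by (auto simp: D_def sum_distrib_right intro!: sum.cong)
    then have "real (D k) * mu \<le> load_factor I * real (capacity I)"
      using \<pi>'(3)[OF \<sigma>_in[OF k]] by (simp add: feasible_path_def)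
    then have "real (D k) \<le> load_factor I * real (capacity I) / mu"
      using mu by (simp add: pos_le_divide_eq)
    then show ?thesis unfolding units_max_def by (simp add: le_nat_iff le_floor_iff)
  qed
  have bound: "tilde_g I S ES ix mu k (D k) \<le> ereal (or_cost I (\<sigma> k))" if k: "k \<in> {1..m}" for k
  proof -
    obtain i where i: "i \<in> set (\<sigma> k)" using ne[OF \<sigma>_in[OF k]] by (meson ex_in_conv)
    \<comment> \<open>This keeps \<open>{k..card S}\<close> nonempty, so the \<open>MIN\<close> in
      \<open>cF_from\<close> is a genuine minimum.\<close>
    have kS: "k \<le> card S" using pos_ge[OF k i] pos(1)[of i] sub[OF k] i by fastforce
    have ixS: "ix j \<in> S" if "j \<in> {k..card S}" for j
      using bij_betwE[OF ix] that k by auto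
    show ?thesis
      unfolding tilde_g_def D_def
    proof (rule tilde_F_le_or_cost)
      show "0 \<le> cF_from I S ix k"
        unfolding cF_from_def using kS ixS S
        by (intro Min.boundedI) (auto intro!: cF_nonneg)
      show "0 \<le> cP_from I S ES ix k"
        unfolding cP_from_def
      proof (intro INF_greatest, clarsimp)
        fix j l assume jl: "k \<le> j" "j \<le> card S" "k \<le> l" "l \<le> card S" "{ix j, ix l} \<in> ES"
        then have "ix j \<noteq> ix l" using ES by (auto simp: edges_within_def doubleton_eq_iff)
        then show "0 \<le> cP I (ix j) (ix l)" using ixS jl S by (intro cP_nonneg) auto
      qed
      show "cF_from I S ix k \<le> cF I j" if "j \<in> set (\<sigma> k)" for j
        unfolding cF_from_def using pos_ge[OF k that] pos[of j] sub[OF k] that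
        by (intro Min_le) (auto intro!: image_eqI[of _ _ "pos j"])
      show "cP_from I S ES ix k \<le> ereal (cP I j l)" if "{j, l} \<in> path_edges (\<sigma> k)" for j l
      proof -
        have "{j, l} \<subseteq> set (\<sigma> k)" using that by (auto simp: path_edges_def doubleton_eq_iff)
        then have jl: "j \<in> set (\<sigma> k)" "l \<in> set (\<sigma> k)" by auto
        then have "j \<in> S" "l \<in> S" using sub[OF k] by auto
        moreover have "{j, l} \<in> ES" using \<pi>'(6)[OF \<sigma>_in[OF k]] that by blast
        \<comment> \<open>By \<open>pos_ge\<close> both endpoints have index at least
          \<open>k\<close>, so their indices compete in the infimum.\<close>
        ultimately show ?thesis
          unfolding cP_from_def using jl[THEN pos_ge[OF k]] pos
          by (intro INF_lower2[of "(pos j, pos l)"]) auto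
      qed
    qed (use mu \<pi>'(3) \<sigma>_in[OF k] pois u sub[OF k] in auto)
  qed
  \<comment> \<open>The \<open>k\<close>-th path selects its own load level; each sum over levels
    then collapses to the term at \<open>D k\<close>.\<close>
  define y :: "nat \<Rightarrow> nat \<Rightarrow> real" where "y k l = (if l = D k then 1 else 0)" for k l
  have "y \<in> assignments I S mu m"
  proof -
    have "(\<Sum>k=1..m. \<Sum>l=0..units_max I mu. real l * y k l) = (\<Sum>k=1..m. real (D k))"
      using D_le by (intro sum.cong) (auto simp: y_def if_distrib[of "(*) _"] cong: if_cong)
    also have "\<dots> = (\<Sum>p\<in>\<pi>. \<Sum>i\<in>set p. real (u i))"
      using sum.reindex_bij_betw[OF \<sigma>(1), of "\<lambda>p. \<Sum>i\<in>set p. real (u i)"] by (simp add: D_def)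
    also have "\<dots> = (\<Sum>i\<in>S. real (u i))"
      unfolding \<pi>'(5)[symmetric]
      using \<pi>' by (intro sum.UNION_disjoint[symmetric]) (auto simp: disjoint_family_on_def)
    also have "\<dots> = units_total I S mu"
      unfolding units_total_def sum_divide_distrib using u mu by (intro sum.cong) auto
    finally have "(\<Sum>k=1..m. \<Sum>l=0..units_max I mu. real l * y k l) = units_total I S mu" .
    then show ?thesis using D_le by (auto simp: assignments_def y_def)
  qed
  then have "L2 I S ES m ix mu \<le>
      (\<Sum>k=1..m. \<Sum>l=0..units_max I mu. tilde_g I S ES ix mu k l * ereal (y k l))"
    unfolding L2_def by (rule INF_lower)
  also have "\<dots> = (\<Sum>k=1..m. tilde_g I S ES ix mu k (D k))"
  proof (rule sum.cong)
    fix k assume k: "k \<in> {1..m}"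
    have "(\<Sum>l=0..units_max I mu. tilde_g I S ES ix mu k l * ereal (y k l)) =
        (\<Sum>l=0..units_max I mu. if l = D k then tilde_g I S ES ix mu k l else 0)"
      by (intro sum.cong) (auto simp: y_def one_ereal_def[symmetric] zero_ereal_def[symmetric])
    also have "\<dots> = tilde_g I S ES ix mu k (D k)" using D_le[OF k] by simp
    finally show "(\<Sum>l=0..units_max I mu. tilde_g I S ES ix mu k l * ereal (y k l)) =
        tilde_g I S ES ix mu k (D k)" .
  qed simp
  also have "\<dots> \<le> (\<Sum>k=1..m. ereal (or_cost I (\<sigma> k)))" by (intro sum_mono bound)
  also have "\<dots> = ereal (\<Sum>p\<in>\<pi>. or_cost I p)"
    using sum.reindex_bij_betw[OF \<sigma>(1), of "or_cost I"] by simp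
  finally show ?thesis .
qed

end

section \<open>Passage to the minimum over partitions\<close>

theorem proposition6:
  fixes I :: "'w vrpsd_data" and S :: "nat set" and ix :: "nat \<Rightarrow> nat" and mu :: real
  assumes "vrpsd I"
    and "S \<subseteq> customers I" and "S \<noteq> {}"
    and "\<forall>i\<in>S. poisson_demand I i"
    and "bij_betw ix {1..card S} S"
    and "mu > 0" and "\<forall>i\<in>S. \<exists>d::int. mean_dem I i = of_int d * mu"
  shows "(\<forall>ES m. ES \<subseteq> edges_within S \<and> 1 \<le> m \<and> enat m \<le> min_edge_paths I S ES \<longrightarrow>
            L2 I S ES m ix mu \<le> edge_opt_cost I S ES m \<and>
            valid_E_coeff I S ES m (L2 I S ES m ix mu))
       \<and> (\<forall>m. 1 \<le> m \<and> enat m \<le> min_paths I S \<longrightarrow>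
            L2 I S (edges_within S) m ix mu \<le> opt_cost I S m \<and>
            valid_S_coeff I S m (L2 I S (edges_within S) m ix mu))"
proof -
  interpret vrpsd I by fact
  have "\<exists>d. mean_dem I i = real d * mu" if i: "i \<in> S" for i
  proof -
    obtain d :: int where d: "mean_dem I i = of_int d * mu" using assms(7) i by blast
    \<comment> \<open>The integer multiplier is nonnegative, so it can serve as a number of unit
      customers.\<close>
    have "0 \<le> mean_dem I i" unfolding mean_dem_def by simp
    then have "0 \<le> d" using d \<open>mu > 0\<close> by (simp add: zero_le_mult_iff)
    then show ?thesis using d by (intro exI[of _ "nat d"]) simp
  qed
  then obtain u where u: "\<And>i. i \<in> S \<Longrightarrow> mean_dem I i = real (u i) * mu" by metis
  \<comment> \<open>Without any partition the right-hand side is \<infinity>, so bounding each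
    partition suffices.\<close>
  have E: "L2 I S ES m ix mu \<le> edge_opt_cost I S ES m" if "ES \<subseteq> edges_within S" for ES m
    unfolding edge_opt_cost_def
    using assms(2,4-6) u that by (intro INF_greatest L2_le_edge_partition) auto
  have "L2 I S (edges_within S) m ix mu \<le> opt_cost I S m" for m
    using E[of "edges_within S" m]
    by (simp add: opt_cost_def edge_opt_cost_def edge_partitions_edges_within)
  with E show ?thesis by (simp add: valid_E_coeff_def valid_S_coeff_def)
qed

end
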